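(* (1) For any bimatrix game $G$, the set $NEP(G)$ of Nash equilibrium payoffs of $G$ is a finite union of rectangles. (2) Conversely, for any nonempty finite union of rectangles $U \subset \mathbb{R}^2$, there exists a bimatrix game $G$ such that $NEP(G) = U$. (3) Moreover, for any bimatrix game $G$, there exists a bimatrix game $G'$ such that $NEP(G') = NEP(G)$ and $CEP(G') = Conv(NEP(G))$.
   Context: A subset of $\mathbb{R}^2$ is called a rectangle if it is of the form $[a,b] \times [c,d]$ for some real numbers $a \le b$ and $c \le d$ (degenerate rectangles are allowed). A bimatrix game is a two-player finite game $G$: each player $i \in \{1,2\}$ has a nonempty finite pure strategy set $S_i$ and a payoff function $u_i : S := S_1 \times S_2 \to \mathbb{R}$. A correlated equilibrium of $G$ is a probability distribution $\mu$ on $S$ such that for every player $i$ and all $s_i, t_i \in S_i$, $\sum_{s_{-i} \in S_{-i}} \mu(s_i,s_{-i})\,[u_i(s_i,s_{-i}) - u_i(t_i,s_{-i})] \ge 0$, where $S_{-i}$ is the strategy set of the other player. For a probability distribution $\mu$ on $S$, $u_i(\mu) := \sum_{s \in S} \mu(s) u_i(s)$. $CEP(G) \subset \mathbb{R}^2$ denotes the set of all $(u_1(\mu),u_2(\mu))$ where $\mu$ is a correlated equilibrium of $G$. $NEP(G) \subset \mathbb{R}^2$ denotes the set of all pairs of expected payoffs of (mixed) Nash equilibria of $G$. $Conv(A)$ denotes the convex hull of $A$. *)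

theory Defs
  imports "HOL-Probability.Probability"
begin

text \<open>
  The payoff functions are total, but every notion below only consults them
  on the strategy profiles of the game.
\<close>

record ('a, 'b) bimatrix =
  strategies1 :: "'a set"
  strategies2 :: "'b set"
  utility1 :: "'a \<times> 'b \<Rightarrow> real"
  utility2 :: "'a \<times> 'b \<Rightarrow> real"

definition bimatrix_game :: "('a, 'b) bimatrix \<Rightarrow> bool" where
  "bimatrix_game G \<longleftrightarrow>
     finite (strategies1 G) \<and> strategies1 G \<noteq> {} \<and>
     finite (strategies2 G) \<and> strategies2 G \<noteq> {}"

definition profiles :: "('a, 'b) bimatrix \<Rightarrow> ('a \<times> 'b) set" where
  "profiles G = strategies1 G \<times> strategies2 G"

definition distributions_on :: "'c set \<Rightarrow> 'c pmf set" where
  "distributions_on A = {\<mu>. set_pmf \<mu> \<subseteq> A}"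

definition payoff1 :: "('a, 'b) bimatrix \<Rightarrow> ('a \<times> 'b) pmf \<Rightarrow> real" where
  "payoff1 G \<mu> = (\<Sum>s\<in>profiles G. pmf \<mu> s * utility1 G s)"

definition payoff2 :: "('a, 'b) bimatrix \<Rightarrow> ('a \<times> 'b) pmf \<Rightarrow> real" where
  "payoff2 G \<mu> = (\<Sum>s\<in>profiles G. pmf \<mu> s * utility2 G s)"

definition correlated_equilibrium :: "('a, 'b) bimatrix \<Rightarrow> ('a \<times> 'b) pmf \<Rightarrow> bool" where
  "correlated_equilibrium G \<mu> \<longleftrightarrow>
     \<mu> \<in> distributions_on (profiles G) \<and>
     (\<forall>s\<in>strategies1 G. \<forall>t\<in>strategies1 G.
        (\<Sum>r\<in>strategies2 G. pmf \<mu> (s, r) * (utility1 G (s, r) - utility1 G (t, r))) \<ge> 0) \<and>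
     (\<forall>s\<in>strategies2 G. \<forall>t\<in>strategies2 G.
        (\<Sum>r\<in>strategies1 G. pmf \<mu> (r, s) * (utility2 G (r, s) - utility2 G (r, t))) \<ge> 0)"

definition nash_equilibrium :: "('a, 'b) bimatrix \<Rightarrow> 'a pmf \<Rightarrow> 'b pmf \<Rightarrow> bool" where
  "nash_equilibrium G p q \<longleftrightarrow>
     p \<in> distributions_on (strategies1 G) \<and>
     q \<in> distributions_on (strategies2 G) \<and>
     (\<forall>p'\<in>distributions_on (strategies1 G).
        payoff1 G (pair_pmf p' q) \<le> payoff1 G (pair_pmf p q)) \<and>
     (\<forall>q'\<in>distributions_on (strategies2 G).
        payoff2 G (pair_pmf p q') \<le> payoff2 G (pair_pmf p q))"

definition CEP :: "('a, 'b) bimatrix \<Rightarrow> (real \<times> real) set" where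
  "CEP G = {(payoff1 G \<mu>, payoff2 G \<mu>) | \<mu>. correlated_equilibrium G \<mu>}"

definition NEP :: "('a, 'b) bimatrix \<Rightarrow> (real \<times> real) set" where
  "NEP G = {(payoff1 G (pair_pmf p q), payoff2 G (pair_pmf p q)) | p q. nash_equilibrium G p q}"

definition rectangle :: "(real \<times> real) set \<Rightarrow> bool" where
  "rectangle R \<longleftrightarrow> (\<exists>a b c d. a \<le> b \<and> c \<le> d \<and> R = {a..b} \<times> {c..d})"

definition finite_union_of_rectangles :: "(real \<times> real) set \<Rightarrow> bool" where
  "finite_union_of_rectangles U \<longleftrightarrow>
     (\<exists>\<R>. finite \<R> \<and> (\<forall>R\<in>\<R>. rectangle R) \<and> U = \<Union>\<R>)"

end

theory Submission
  imports Defs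
begin

text \<open>
  Fix sets of strategies \<open>I\<close>, \<open>J\<close> and look at the equilibria whose supports lie in \<open>I\<close> and \<open>J\<close> and
  for which all of \<open>I\<close> and \<open>J\<close> are best replies. They form a product of two polytopes, and each
  player's payoff on it is a linear function of the opponent's mixture alone; so the payoffs form
  a rectangle.

  Conversely, for rectangles \<open>R\<^sub>0, \<dots>, R\<^sub>n\<^sub>-\<^sub>1\<close> give both players \<open>n\<close> blocks of two strategies, let each
  player's choice inside block \<open>k\<close> select an end point of the side of \<open>R\<^sub>k\<close> that belongs to the
  opponent, and charge a penalty of 1 for choosing a higher block than the opponent. Deviating to
  the lowest block never pays a penalty, so a distribution is a correlated equilibrium iff it is
  supported on pairs in equal blocks. A product distribution of this kind lives in a single block,
  whence the Nash payoffs are the union and the correlated payoffs its convex hull.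

  For the last claim the payoff set has to be nonempty, which is Nash's theorem. Its dimension
  depends on the game, so Brouwer's theorem is needed for cubes with a variable set of
  coordinates and is obtained from Kuhn's combinatorial lemma.
\<close>

subsection \<open>Brouwer's theorem on cubes of functions\<close>

lemma compact_product_fun:
  fixes S :: "'i \<Rightarrow> 'c::topological_space set"
  assumes "\<And>i. compact (S i)"
  shows "compact (Pi UNIV S)"
proof -
  have "compactin (product_topology (\<lambda>i. euclidean) UNIV) (PiE UNIV S)"
    using assms by (subst compactin_PiE) simp
  then show ?thesis
    by (simp add: euclidean_product_topology PiE_UNIV_domain)
qed

lemma tendsto_fun_iff:
  fixes f :: "'n \<Rightarrow> 'i \<Rightarrow> 'c::topological_space"
  shows "(f \<longlongrightarrow> l) F \<longleftrightarrow> (\<forall>i. ((\<lambda>n. f n i) \<longlongrightarrow> l i) F)"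
proof -
  have "limitin (product_topology (\<lambda>i. euclidean) UNIV) f l F \<longleftrightarrow> (\<forall>i. ((\<lambda>n. f n i) \<longlongrightarrow> l i) F)"
    by (subst limitin_componentwise) simp
  then show ?thesis by (simp add: euclidean_product_topology)
qed

text \<open>Coordinates outside \<open>C\<close> are pinned to 0, so cubes of every finite dimension
  live in one function type and stay compact there.\<close>

definition unit_cube :: "'i set \<Rightarrow> ('i \<Rightarrow> real) set" where
  "unit_cube C = Pi UNIV (\<lambda>i. if i \<in> C then {0..1} else {0})"

lemma unit_cube_iff:
  "x \<in> unit_cube C \<longleftrightarrow> (\<forall>i\<in>C. 0 \<le> x i \<and> x i \<le> 1) \<and> (\<forall>i. i \<notin> C \<longrightarrow> x i = 0)"
  by (auto simp: unit_cube_def Pi_iff split: if_splits)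

lemma compact_unit_cube: "compact (unit_cube C)"
  unfolding unit_cube_def by (rule compact_product_fun) simp

lemma continuous_on_coordinate: "continuous_on S (\<lambda>x. x i)"
  by (rule continuous_on_subset[OF continuous_on_product_coordinates]) simp

text \<open>On a grid of mesh \<open>1 / Suc p\<close>, Kuhn's lemma finds a cell where, for each
  coordinate, \<open>f\<close> does not decrease that coordinate at one corner and does not increase
  it at another. Along a subsequence these cells shrink to a point, which is fixed by
  continuity.\<close>

lemma brouwer_unit_cube_nat:
  fixes n :: nat and f :: "(nat \<Rightarrow> real) \<Rightarrow> nat \<Rightarrow> real"
  defines "K \<equiv> unit_cube {..<n}"
  assumes cont: "continuous_on K f" and into: "f \<in> K \<rightarrow> K"
  shows "\<exists>x\<in>K. f x = x"
proof -
  define pt :: "nat \<Rightarrow> (nat \<Rightarrow> nat) \<Rightarrow> nat \<Rightarrow> real"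
    where "pt p r = (\<lambda>i. if i < n then real (r i) / real p else 0)" for p r
  have ptK: "pt p r \<in> K" if "\<forall>i<n. r i \<le> p" for p r
    using that by (auto simp: pt_def K_def unit_cube_iff divide_le_eq_1)
  have fK: "0 \<le> f x i" "f x i \<le> 1" if "x \<in> K" "i < n" for x i
    using into that by (auto simp: K_def Pi_iff unit_cube_iff)
  have ex: "\<exists>q. (\<forall>i<n. q i < Suc p) \<and> (\<forall>i<n. \<exists>r s.
      (\<forall>j<n. q j \<le> r j \<and> r j \<le> q j + 1) \<and> (\<forall>j<n. q j \<le> s j \<and> s j \<le> q j + 1) \<and>
      pt (Suc p) r i \<le> f (pt (Suc p) r) i \<and> f (pt (Suc p) s) i \<le> pt (Suc p) s i)" for p
  proof -
    \<comment> \<open>Label 0 means that \<open>f\<close> does not decrease coordinate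
      \<open>i\<close>, label 1 that it does not increase it. The values forced at 0 and
      \<open>Suc p\<close> are the boundary conditions of Kuhn's lemma; they agree with this meaning
      because \<open>f\<close> maps into the cube.\<close>
    define label where "label x i = (if x i = 0 then 0 else if x i = Suc p then 1
      else if pt (Suc p) x i \<le> f (pt (Suc p) x) i then 0 else (1::nat))" for x i
    have below: "pt (Suc p) x i \<le> f (pt (Suc p) x) i"
      if "\<forall>j<n. x j \<le> Suc p" "i < n" "label x i = 0" for x i
      using that fK[OF ptK[OF that(1)] that(2)]
      by (auto simp: label_def pt_def split: if_splits)
    have above: "f (pt (Suc p) x) i \<le> pt (Suc p) x i"
      if "\<forall>j<n. x j \<le> Suc p" "i < n" "label x i \<noteq> 0" for x i
      using that fK[OF ptK[OF that(1)] that(2)]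
      by (auto simp: label_def pt_def split: if_splits simp del: of_nat_Suc)
    obtain q where q: "\<forall>i<n. q i < Suc p" and
      near: "\<forall>i<n. \<exists>r s. (\<forall>j<n. q j \<le> r j \<and> r j \<le> q j + 1) \<and>
        (\<forall>j<n. q j \<le> s j \<and> s j \<le> q j + 1) \<and> label r i \<noteq> label s i"
      by (rule kuhn_lemma[of "Suc p" n label]) (auto simp: label_def)
    have "\<exists>r s. (\<forall>j<n. q j \<le> r j \<and> r j \<le> q j + 1) \<and> (\<forall>j<n. q j \<le> s j \<and> s j \<le> q j + 1) \<and>
        pt (Suc p) r i \<le> f (pt (Suc p) r) i \<and> f (pt (Suc p) s) i \<le> pt (Suc p) s i"
      if "i < n" for i
    proof -
      obtain r s where r: "\<forall>j<n. q j \<le> r j \<and> r j \<le> q j + 1"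
        and s: "\<forall>j<n. q j \<le> s j \<and> s j \<le> q j + 1" and ne: "label r i \<noteq> label s i"
        using near \<open>i < n\<close> by blast
      have r': "\<forall>j<n. r j \<le> Suc p" and s': "\<forall>j<n. s j \<le> Suc p"
        using q r s by fastforce+
      show ?thesis
      proof (cases "label r i = 0")
        case True
        then show ?thesis using r s ne below[OF r' that] above[OF s' that]
          by (intro exI[of _ r] exI[of _ s]) simp
      next
        case False
        then have "label s i = 0" using ne by (auto simp: label_def split: if_splits)
        then show ?thesis using r s False below[OF s' that] above[OF r' that]
          by (intro exI[of _ s] exI[of _ r]) simp
      qed
    qed
    then show ?thesis using q by blast
  qed
  then obtain Q where Q: "\<And>p i. i < n \<Longrightarrow> Q p i < Suc p" and
    ex2: "\<And>p i. i < n \<Longrightarrow> \<exists>r s.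
      (\<forall>j<n. Q p j \<le> r j \<and> r j \<le> Q p j + 1) \<and> (\<forall>j<n. Q p j \<le> s j \<and> s j \<le> Q p j + 1) \<and>
      pt (Suc p) r i \<le> f (pt (Suc p) r) i \<and> f (pt (Suc p) s) i \<le> pt (Suc p) s i"
    by metis
  obtain R S where
    R: "\<And>p i j. \<lbrakk>i < n; j < n\<rbrakk> \<Longrightarrow> Q p j \<le> R p i j \<and> R p i j \<le> Q p j + 1" and
    S: "\<And>p i j. \<lbrakk>i < n; j < n\<rbrakk> \<Longrightarrow> Q p j \<le> S p i j \<and> S p i j \<le> Q p j + 1" and
    Rf: "\<And>p i. i < n \<Longrightarrow> pt (Suc p) (R p i) i \<le> f (pt (Suc p) (R p i)) i" and
    Sf: "\<And>p i. i < n \<Longrightarrow> f (pt (Suc p) (S p i)) i \<le> pt (Suc p) (S p i) i"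
  proof -
    define P where "P p i r s \<longleftrightarrow> (\<forall>j<n. Q p j \<le> r j \<and> r j \<le> Q p j + 1) \<and>
      (\<forall>j<n. Q p j \<le> s j \<and> s j \<le> Q p j + 1) \<and>
      pt (Suc p) r i \<le> f (pt (Suc p) r) i \<and> f (pt (Suc p) s) i \<le> pt (Suc p) s i" for p i r s
    have "\<forall>p i. \<exists>r s. i < n \<longrightarrow> P p i r s"
      using ex2 unfolding P_def by blast
    then obtain R S where "\<And>p i. i < n \<Longrightarrow> P p i (R p i) (S p i)" by metis
    then show thesis by (intro that[of R S]) (auto simp: P_def)
  qed
  have "compact K" unfolding K_def by (rule compact_unit_cube)
  then have "seq_compact K" by (rule compact_imp_seq_compact)
  moreover have "\<forall>p. pt (Suc p) (Q p) \<in> K"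
    using Q by (auto intro!: ptK less_imp_le)
  ultimately obtain z \<phi> where z: "z \<in> K" and \<phi>: "strict_mono \<phi>"
    and lim: "((\<lambda>p. pt (Suc p) (Q p)) \<circ> \<phi>) \<longlonglongrightarrow> z"
    by (rule seq_compactE)
  \<comment> \<open>Any corner \<open>T p\<close> of the cell at \<open>Q p\<close> is within
    \<open>1 / Suc p\<close> of it in each coordinate, so all corners share the limit
    \<open>z\<close>.\<close>
  have near_lim: "(\<lambda>k. pt (Suc (\<phi> k)) (T (\<phi> k))) \<longlonglongrightarrow> z"
    if T: "\<And>p j. j < n \<Longrightarrow> Q p j \<le> T p j \<and> T p j \<le> Q p j + 1" for T
    unfolding tendsto_fun_iff
  proof
    fix j
    have l: "(\<lambda>k. pt (Suc (\<phi> k)) (Q (\<phi> k)) j) \<longlonglongrightarrow> z j"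
      using lim by (simp add: tendsto_fun_iff)
    have "(\<lambda>k. 1 / real (Suc k)) \<longlonglongrightarrow> 0" by (rule LIMSEQ_Suc[OF lim_1_over_n])
    then have "(\<lambda>k. 1 / real (Suc (\<phi> k))) \<longlonglongrightarrow> 0"
      using LIMSEQ_subseq_LIMSEQ[OF _ \<phi>] by (fastforce simp: o_def)
    from tendsto_add[OF l this]
    have u: "(\<lambda>k. pt (Suc (\<phi> k)) (Q (\<phi> k)) j + 1 / real (Suc (\<phi> k))) \<longlonglongrightarrow> z j" by simp
    have "pt (Suc p) (Q p) j \<le> pt (Suc p) (T p) j \<and>
        pt (Suc p) (T p) j \<le> pt (Suc p) (Q p) j + 1 / real (Suc p)" for p
    proof (cases "j < n")
      case True
      have "real (Q p j) \<le> real (T p j)" "real (T p j) \<le> real (Q p j) + 1"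
        using T[OF True, of p] by linarith+
      then show ?thesis using True
        by (simp add: pt_def divide_right_mono flip: add_divide_distrib del: of_nat_Suc)
    qed (simp add: pt_def)
    then show "(\<lambda>k. pt (Suc (\<phi> k)) (T (\<phi> k)) j) \<longlonglongrightarrow> z j"
      by (intro tendsto_sandwich[OF _ _ l u]) auto
  qed
  have f_lim: "(\<lambda>k. f (pt (Suc (\<phi> k)) (T (\<phi> k))) i) \<longlonglongrightarrow> f z i"
    if T: "\<And>p j. j < n \<Longrightarrow> Q p j \<le> T p j \<and> T p j \<le> Q p j + 1" for T i
  proof -
    have "pt (Suc p) (T p) \<in> K" for p
      using T[of _ p] Q[of _ p] by (intro ptK) fastforce
    then have "(\<lambda>k. f (pt (Suc (\<phi> k)) (T (\<phi> k)))) \<longlonglongrightarrow> f z"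
      using continuous_on_tendsto_compose[OF cont near_lim[OF T] z] by simp
    then show ?thesis by (simp add: tendsto_fun_iff)
  qed
  \<comment> \<open>The corners \<open>R\<close> and \<open>S\<close> give the two opposite
    inequalities in the limit.\<close>
  have "f z i = z i" for i
  proof (cases "i < n")
    case True
    have "z i \<le> f z i"
      using near_lim[of "\<lambda>p. R p i"] f_lim[of "\<lambda>p. R p i" i] R Rf True
      by (intro LIMSEQ_le[of "\<lambda>k. pt (Suc (\<phi> k)) (R (\<phi> k) i) i"]) (auto simp: tendsto_fun_iff)
    moreover have "f z i \<le> z i"
      using near_lim[of "\<lambda>p. S p i"] f_lim[of "\<lambda>p. S p i" i] S Sf True
      by (intro LIMSEQ_le[where Y = "\<lambda>k. pt (Suc (\<phi> k)) (S (\<phi> k) i) i"]) (auto simp: tendsto_fun_iff)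
    ultimately show ?thesis by simp
  next
    case False
    have "f z \<in> K" using into z by auto
    then show ?thesis using z False by (auto simp: K_def unit_cube_iff)
  qed
  then show ?thesis using z by blast
qed

text \<open>Conjugation by an enumeration \<open>e\<close> of \<open>C\<close>: if \<open>y\<close>
  is fixed by \<open>fro\<close> after \<open>f\<close> after \<open>to\<close>, then
  \<open>to y\<close> is fixed by \<open>f\<close>, since \<open>to\<close> undoes
  \<open>fro\<close> on \<open>K\<close>.\<close>

lemma brouwer_unit_cube:
  fixes C :: "'i set" and f :: "('i \<Rightarrow> real) \<Rightarrow> 'i \<Rightarrow> real"
  assumes "finite C"
  defines "K \<equiv> unit_cube C"
  assumes cont: "continuous_on K f" and into: "f \<in> K \<rightarrow> K"
  shows "\<exists>x\<in>K. f x = x"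
proof -
  obtain e where "bij_betw e {0..<card C} C"
    using ex_bij_betw_nat_finite[OF \<open>finite C\<close>] by blast
  then have e: "bij_betw e {..<card C} C" by (simp add: atLeast0LessThan)
  define d where "d = the_inv_into {..<card C} e"
  have d: "d c < card C" "e (d c) = c" if "c \<in> C" for c
    using that e unfolding d_def
    by (auto simp: bij_betw_def f_the_inv_into_f dest: the_inv_into_into[of e _ _ "{..<card C}"])
  have de: "e i \<in> C" "d (e i) = i" if "i < card C" for i
    using that e unfolding d_def by (auto simp: bij_betw_def the_inv_into_f_f)
  define N where "N = unit_cube {..<card C}"
  define to where "to y c = (if c \<in> C then y (d c) else 0)" for y :: "nat \<Rightarrow> real" and c
  define fro where "fro x i = (if i < card C then x (e i) else 0)" for x :: "'i \<Rightarrow> real" and i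
  have to: "to \<in> N \<rightarrow> K" using d by (auto simp: to_def N_def K_def Pi_iff unit_cube_iff)
  have fro: "fro \<in> K \<rightarrow> N" using de by (auto simp: fro_def N_def K_def Pi_iff unit_cube_iff)
  have to_fro: "to (fro x) = x" if "x \<in> K" for x
    using that d by (auto simp: to_def fro_def K_def unit_cube_iff fun_eq_iff)
  have cto: "continuous_on N to"
  proof (intro continuous_on_coordinatewise_then_product)
    show "continuous_on N (\<lambda>y. to y c)" for c
      by (cases "c \<in> C") (simp_all add: to_def continuous_on_coordinate)
  qed
  have cfro: "continuous_on K fro"
  proof (intro continuous_on_coordinatewise_then_product)
    show "continuous_on K (\<lambda>x. fro x i)" for i
      by (cases "i < card C") (simp_all add: fro_def continuous_on_coordinate)
  qed
  have "continuous_on N (\<lambda>y. fro (f (to y)))"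
    using to into
    by (intro continuous_on_compose2[OF cfro] continuous_on_compose2[OF cont] cto) auto
  moreover have "(\<lambda>y. fro (f (to y))) \<in> N \<rightarrow> N"
    using to into fro by auto
  ultimately obtain y where y: "y \<in> N" "fro (f (to y)) = y"
    using brouwer_unit_cube_nat[of "card C" "\<lambda>y. fro (f (to y))"] unfolding N_def by blast
  have "f (to y) = to y"
    using y(2) to_fro[of "f (to y)"] to into y(1) by (metis funcset_mem)
  then show ?thesis using to y(1) by (metis funcset_mem)
qed

subsection \<open>Existence of Nash equilibria\<close>

definition prob_simplex :: "'i set \<Rightarrow> ('i \<Rightarrow> real) set" where
  "prob_simplex S = {x. (\<forall>i\<in>S. 0 \<le> x i) \<and> (\<forall>i. i \<notin> S \<longrightarrow> x i = 0) \<and> sum x S = 1}"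

lemma prob_simplex_le_1:
  assumes "finite S" "x \<in> prob_simplex S" shows "x i \<le> 1"
proof (cases "i \<in> S")
  case True
  then have "x i \<le> sum x S"
    using assms by (intro member_le_sum) (auto simp: prob_simplex_def)
  then show ?thesis using assms by (simp add: prob_simplex_def)
qed (use assms in \<open>simp add: prob_simplex_def\<close>)

lemma prob_simplex_subset_unit_cube:
  assumes "finite S" shows "prob_simplex S \<subseteq> unit_cube S"
proof
  fix x assume x: "x \<in> prob_simplex S"
  then have "0 \<le> x i" "i \<notin> S \<Longrightarrow> x i = 0" "x i \<le> 1" for i
    using prob_simplex_le_1[OF assms x] by (cases "i \<in> S"; simp add: prob_simplex_def)+
  then show "x \<in> unit_cube S" by (simp add: unit_cube_iff)
qed

text \<open>A continuous retraction of nonnegative vectors onto the simplex: mass missing from 1 is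
  spread evenly over \<open>S\<close>, mass beyond 1 is scaled away.\<close>

definition to_simplex :: "'i set \<Rightarrow> ('i \<Rightarrow> real) \<Rightarrow> 'i \<Rightarrow> real" where
  "to_simplex S x = (\<lambda>i. if i \<in> S
     then (x i + max 0 (1 - sum x S) / card S) / max 1 (sum x S) else 0)"

lemma to_simplex_in:
  assumes "finite S" "S \<noteq> {}" "\<And>i. i \<in> S \<Longrightarrow> 0 \<le> x i"
  shows "to_simplex S x \<in> prob_simplex S"
proof -
  have "(\<Sum>i\<in>S. x i + max 0 (1 - sum x S) / card S) = sum x S + max 0 (1 - sum x S)"
    using assms by (simp add: sum.distrib)
  also have "\<dots> = max 1 (sum x S)" by simp
  finally have "(\<Sum>i\<in>S. to_simplex S x i) = 1"
    by (simp add: to_simplex_def flip: sum_divide_distrib)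
  then show ?thesis using assms by (simp add: prob_simplex_def to_simplex_def)
qed

lemma to_simplex_id: "x \<in> prob_simplex S \<Longrightarrow> to_simplex S x = x"
  by (auto simp: prob_simplex_def to_simplex_def)

lemma continuous_on_to_simplex:
  assumes "finite S" and "\<And>i. continuous_on K (\<lambda>z. x z i)"
  shows "continuous_on K (\<lambda>z. to_simplex S (x z) i)"
proof (cases "i \<in> S")
  case True
  then have "real (card S) \<noteq> 0" using \<open>finite S\<close> by auto
  moreover have "max 1 (sum (x z) S) \<noteq> 0" for z by linarith
  ultimately have "continuous_on K (\<lambda>z. (x z i + max 0 (1 - sum (x z) S) / card S) / max 1 (sum (x z) S))"
    by (intro continuous_on_divide continuous_on_add continuous_on_max continuous_on_diff
        continuous_on_sum continuous_on_const assms(2) ballI)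
  then show ?thesis using True by (simp add: to_simplex_def)
qed (simp add: to_simplex_def)

text \<open>Nash's map for one player: \<open>x\<close> is the current mixture and
  \<open>v i\<close> the payoff of pure strategy \<open>i\<close>. Each weight grows by the gain of
  its strategy over the average, and the result is renormalized.\<close>

definition nash_map :: "'i set \<Rightarrow> ('i \<Rightarrow> real) \<Rightarrow> ('i \<Rightarrow> real) \<Rightarrow> 'i \<Rightarrow> real" where
  "nash_map S v x = (\<lambda>i. if i \<in> S
     then (x i + max 0 (v i - (\<Sum>k\<in>S. x k * v k))) /
       (1 + (\<Sum>j\<in>S. max 0 (v j - (\<Sum>k\<in>S. x k * v k)))) else 0)"

lemma one_plus_gains_pos: "0 < 1 + (\<Sum>j\<in>S. max 0 (g j :: real))"
  by (intro add_pos_nonneg sum_nonneg) auto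

lemma nash_map_in:
  assumes "x \<in> prob_simplex S" shows "nash_map S v x \<in> prob_simplex S"
proof -
  note pos = one_plus_gains_pos[of "\<lambda>j. v j - (\<Sum>k\<in>S. x k * v k)" S]
  have "sum (nash_map S v x) S = 1"
    using assms pos by (simp add: nash_map_def prob_simplex_def sum.distrib flip: sum_divide_distrib)
  then show ?thesis
    using assms pos by (auto simp: prob_simplex_def nash_map_def intro!: divide_nonneg_pos add_nonneg_nonneg)
qed

lemma continuous_on_nash_map:
  assumes "\<And>i. continuous_on K (\<lambda>z. x z i)" "\<And>i. continuous_on K (\<lambda>z. v z i)"
  shows "continuous_on K (\<lambda>z. nash_map S (v z) (x z) i)"
proof (cases "i \<in> S")
  case True
  have "1 + (\<Sum>j\<in>S. max 0 (v z j - (\<Sum>k\<in>S. x z k * v z k))) \<noteq> 0" for z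
    using one_plus_gains_pos[of "\<lambda>j. v z j - (\<Sum>k\<in>S. x z k * v z k)" S] by linarith
  then have "continuous_on K (\<lambda>z. (x z i + max 0 (v z i - (\<Sum>k\<in>S. x z k * v z k))) /
      (1 + (\<Sum>j\<in>S. max 0 (v z j - (\<Sum>k\<in>S. x z k * v z k)))))"
    by (intro continuous_on_divide continuous_on_add continuous_on_max continuous_on_diff
        continuous_on_mult continuous_on_sum continuous_on_const assms ballI)
  then show ?thesis using True by (simp add: nash_map_def)
qed (simp add: nash_map_def)

text \<open>Some strategy in the support does not beat the average, so its gain vanishes; at a fixed
  point this forces the total gain to vanish.\<close>

lemma nash_map_fixed:
  assumes "finite S" and x: "x \<in> prob_simplex S" and fixed: "nash_map S v x = x" and "i \<in> S"
  shows "v i \<le> (\<Sum>k\<in>S. x k * v k)"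
proof -
  define w where "w = (\<Sum>k\<in>S. x k * v k)"
  define T where "T = (\<Sum>j\<in>S. max 0 (v j - w))"
  have "\<exists>k\<in>S. 0 < x k \<and> v k \<le> w"
  proof (rule ccontr)
    assume a: "\<not> ?thesis"
    have le: "x k * w \<le> x k * v k" if "k \<in> S" for k
    proof (cases "x k = 0")
      case False
      then have "0 < x k" using that x by (auto simp: prob_simplex_def less_le)
      then show ?thesis using a that by (auto simp: not_le)
    qed simp
    have "\<exists>k\<in>S. x k \<noteq> 0"
    proof (rule ccontr)
      assume "\<not> ?thesis"
      then have "sum x S = 0" by simp
      then show False using x by (simp add: prob_simplex_def)
    qed
    then obtain k where k: "k \<in> S" "x k \<noteq> 0" by blast
    then have "0 < x k" using x by (auto simp: prob_simplex_def less_le)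
    then have "x k * w < x k * v k" using a k by (auto simp: not_le)
    with le k(1) have "(\<Sum>k\<in>S. x k * w) < (\<Sum>k\<in>S. x k * v k)"
      using \<open>finite S\<close> by (intro sum_strict_mono_ex1) auto
    moreover have "(\<Sum>k\<in>S. x k * w) = w"
      using x by (simp add: prob_simplex_def flip: sum_distrib_right)
    ultimately show False by (simp add: w_def)
  qed
  then obtain k where k: "k \<in> S" "0 < x k" "v k \<le> w" by blast
  have pos: "0 < 1 + T" unfolding T_def by (rule one_plus_gains_pos)
  \<comment> \<open>Coordinate \<open>k\<close> has gain 0, so the fixed-point equation there reads
    \<open>x k = x k / (1 + T)\<close>.\<close>
  have "x k = (x k + max 0 (v k - w)) / (1 + T)"
    using fun_cong[OF fixed, of k] k(1) by (simp add: nash_map_def w_def T_def)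
  then have "x k * T = 0"
    using k(3) pos by (simp add: field_simps)
  then have "T = 0" using k(2) by simp
  then have "max 0 (v i - w) = 0"
    using \<open>finite S\<close> \<open>i \<in> S\<close> unfolding T_def by (subst (asm) sum_nonneg_eq_0_iff) auto
  then show ?thesis unfolding w_def by linarith
qed

text \<open>Brouwer's theorem is applied to one cube over the disjoint sum of the strategy sets: a
  point is first retracted to a pair of mixed strategies, then Nash's map acts on each component. At
  a fixed point no pure strategy beats the average.\<close>

lemma mixed_equilibrium_exists:
  fixes u1 u2 :: "'a \<times> 'b \<Rightarrow> real"
  assumes A: "finite A" "A \<noteq> {}" and B: "finite B" "B \<noteq> {}"
  shows "\<exists>x\<in>prob_simplex A. \<exists>y\<in>prob_simplex B.
    (\<forall>i\<in>A. (\<Sum>j\<in>B. y j * u1 (i, j)) \<le> (\<Sum>k\<in>A. x k * (\<Sum>j\<in>B. y j * u1 (k, j)))) \<and>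
    (\<forall>j\<in>B. (\<Sum>i\<in>A. x i * u2 (i, j)) \<le> (\<Sum>k\<in>B. y k * (\<Sum>i\<in>A. x i * u2 (i, k))))"
proof -
  define X where "X z = to_simplex A (\<lambda>i. z (Inl i))" for z :: "'a + 'b \<Rightarrow> real"
  define Y where "Y z = to_simplex B (\<lambda>j. z (Inr j))" for z :: "'a + 'b \<Rightarrow> real"
  define v1 where "v1 z i = (\<Sum>j\<in>B. Y z j * u1 (i, j))" for z i
  define v2 where "v2 z j = (\<Sum>i\<in>A. X z i * u2 (i, j))" for z j
  define f where "f z = case_sum (nash_map A (v1 z) (X z)) (nash_map B (v2 z) (Y z))" for z
  define K where "K = unit_cube (A <+> B)"
  have X: "X z \<in> prob_simplex A" if "z \<in> K" for z
    using that A unfolding X_def by (intro to_simplex_in) (auto simp: K_def unit_cube_iff)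
  have Y: "Y z \<in> prob_simplex B" if "z \<in> K" for z
    using that B unfolding Y_def by (intro to_simplex_in) (auto simp: K_def unit_cube_iff)
  have cX: "continuous_on K (\<lambda>z. X z i)" for i
    unfolding X_def by (intro continuous_on_to_simplex continuous_on_coordinate A(1))
  have cY: "continuous_on K (\<lambda>z. Y z j)" for j
    unfolding Y_def by (intro continuous_on_to_simplex continuous_on_coordinate B(1))
  have cv1: "continuous_on K (\<lambda>z. v1 z i)" for i
    unfolding v1_def by (intro continuous_on_sum continuous_on_mult continuous_on_const cY)
  have cv2: "continuous_on K (\<lambda>z. v2 z j)" for j
    unfolding v2_def by (intro continuous_on_sum continuous_on_mult continuous_on_const cX)
  have "continuous_on K f"
  proof (intro continuous_on_coordinatewise_then_product)
    fix c
    show "continuous_on K (\<lambda>z. f z c)"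
      by (cases c) (simp_all add: f_def continuous_on_nash_map cX cY cv1 cv2)
  qed
  moreover have "f \<in> K \<rightarrow> K"
  proof
    fix z assume z: "z \<in> K"
    have a: "nash_map A (v1 z) (X z) \<in> unit_cube A"
      by (rule subsetD[OF prob_simplex_subset_unit_cube[OF A(1)] nash_map_in[OF X[OF z]]])
    have b: "nash_map B (v2 z) (Y z) \<in> unit_cube B"
      by (rule subsetD[OF prob_simplex_subset_unit_cube[OF B(1)] nash_map_in[OF Y[OF z]]])
    have "(c \<in> A <+> B \<longrightarrow> 0 \<le> f z c \<and> f z c \<le> 1) \<and> (c \<notin> A <+> B \<longrightarrow> f z c = 0)" for c
      using a b by (cases c) (simp_all add: f_def unit_cube_iff Plus_def image_iff)
    then show "f z \<in> K" by (simp add: K_def unit_cube_iff)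
  qed
  ultimately obtain z where z: "z \<in> K" "f z = z"
    using brouwer_unit_cube[of "A <+> B" f] A(1) B(1) unfolding K_def by auto
  have zl: "nash_map A (v1 z) (X z) = (\<lambda>i. z (Inl i))"
  proof
    show "nash_map A (v1 z) (X z) i = z (Inl i)" for i
      using fun_cong[OF z(2), of "Inl i"] by (simp add: f_def)
  qed
  have zr: "nash_map B (v2 z) (Y z) = (\<lambda>j. z (Inr j))"
  proof
    show "nash_map B (v2 z) (Y z) j = z (Inr j)" for j
      using fun_cong[OF z(2), of "Inr j"] by (simp add: f_def)
  qed
  \<comment> \<open>Values of \<open>nash_map\<close> lie in the simplex, so the fixed point already
    consists of mixed strategies and the retraction leaves it unchanged.\<close>
  have "X z = (\<lambda>i. z (Inl i))"
    unfolding X_def using nash_map_in[OF X[OF z(1)], of "v1 z"] unfolding zl by (rule to_simplex_id)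
  then have fx: "nash_map A (v1 z) (X z) = X z" using zl by simp
  have "Y z = (\<lambda>i. z (Inr i))"
    unfolding Y_def using nash_map_in[OF Y[OF z(1)], of "v2 z"] unfolding zr by (rule to_simplex_id)
  then have fy: "nash_map B (v2 z) (Y z) = Y z" using zr by simp
  show ?thesis
  proof (intro bexI conjI ballI)
    show "(\<Sum>j\<in>B. Y z j * u1 (i, j)) \<le> (\<Sum>k\<in>A. X z k * (\<Sum>j\<in>B. Y z j * u1 (k, j)))"
      if "i \<in> A" for i
      using nash_map_fixed[OF A(1) X[OF z(1)] fx that] by (simp add: v1_def)
    show "(\<Sum>i\<in>A. X z i * u2 (i, j)) \<le> (\<Sum>k\<in>B. Y z k * (\<Sum>i\<in>A. X z i * u2 (i, k)))"
      if "j \<in> B" for j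
      using nash_map_fixed[OF B(1) Y[OF z(1)] fy that] by (simp add: v2_def)
  qed (fact X[OF z(1)] Y[OF z(1)])+
qed

section \<open>Mixed strategies as points of the simplex, and best replies\<close>

lemma pmf_of_prob_simplex:
  assumes "finite S" "x \<in> prob_simplex S"
  obtains p where "pmf p = x" "set_pmf p \<subseteq> S"
proof -
  have nn: "0 \<le> x i" for i using assms by (cases "i \<in> S") (auto simp: prob_simplex_def)
  have "(\<integral>\<^sup>+ i. ennreal (x i) \<partial>count_space UNIV) = (\<Sum>i\<in>S. ennreal (x i))"
    using assms by (intro nn_integral_count_space') (auto simp: prob_simplex_def)
  also have "\<dots> = 1"
    using assms nn by (simp add: sum_ennreal prob_simplex_def)
  finally have p: "pmf (embed_pmf x) i = x i" for i
    using nn by (intro pmf_embed_pmf) auto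
  show thesis
  proof (rule that[of "embed_pmf x"])
    show "set_pmf (embed_pmf x) \<subseteq> S"
      using p assms by (auto simp: set_pmf_iff prob_simplex_def)
  qed (use p in auto)
qed

lemma pmf_in_prob_simplex: "finite S \<Longrightarrow> set_pmf p \<subseteq> S \<Longrightarrow> pmf p \<in> prob_simplex S"
  by (auto simp: prob_simplex_def sum_pmf_eq_1 set_pmf_iff)

lemma sum_pmf_const:
  fixes f :: "'c \<Rightarrow> real"
  assumes "finite S" "set_pmf p \<subseteq> S" "\<And>s. s \<in> set_pmf p \<Longrightarrow> f s = c"
  shows "(\<Sum>s\<in>S. pmf p s * f s) = c"
proof -
  have "(\<Sum>s\<in>S. pmf p s * f s) = (\<Sum>s\<in>S. pmf p s * c)"
    using assms(3) by (intro sum.cong) (auto simp: set_pmf_iff)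
  then show ?thesis using sum_pmf_eq_1[OF assms(1,2)] by (simp flip: sum_distrib_right)
qed

lemma sum_pmf_le:
  fixes f :: "'c \<Rightarrow> real"
  assumes "finite S" "set_pmf p \<subseteq> S" "\<And>s. s \<in> set_pmf p \<Longrightarrow> f s \<le> c"
  shows "(\<Sum>s\<in>S. pmf p s * f s) \<le> c"
proof -
  have "(\<Sum>s\<in>S. pmf p s * f s) \<le> (\<Sum>s\<in>S. pmf p s * c)"
  proof (rule sum_mono)
    show "pmf p s * f s \<le> pmf p s * c" for s
      using assms(3) by (cases "s \<in> set_pmf p") (auto simp: set_pmf_iff intro: mult_left_mono)
  qed
  also have "\<dots> = c"
    using sum_pmf_eq_1[OF assms(1,2)] by (simp flip: sum_distrib_right)
  finally show ?thesis .
qed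

lemma sum_pmf_ge:
  fixes f :: "'c \<Rightarrow> real"
  assumes "finite S" "set_pmf p \<subseteq> S" "\<And>s. s \<in> set_pmf p \<Longrightarrow> c \<le> f s"
  shows "c \<le> (\<Sum>s\<in>S. pmf p s * f s)"
  using sum_pmf_le[OF assms(1,2), of "\<lambda>s. - f s" "- c"] assms(3) by (simp add: sum_negf)

text \<open>The expectation is linear in the mixture, so its maximum is the maximum of
  \<open>f\<close> on \<open>S\<close>, attained exactly by the mixtures of maximizers. This reduces
  deviations to pure ones.\<close>

lemma best_reply_iff:
  fixes f :: "'c \<Rightarrow> real"
  assumes "finite S" "set_pmf p \<subseteq> S"
  shows "(\<forall>p'\<in>distributions_on S. (\<Sum>s\<in>S. pmf p' s * f s) \<le> (\<Sum>s\<in>S. pmf p s * f s)) \<longleftrightarrow>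
    (\<forall>i\<in>set_pmf p. \<forall>t\<in>S. f t \<le> f i)" (is "?L \<longleftrightarrow> ?R")
proof
  define v where "v = (\<Sum>s\<in>S. pmf p s * f s)"
  assume L: ?L
  have le: "f t \<le> v" if "t \<in> S" for t
  proof -
    have "return_pmf t \<in> distributions_on S" using that by (simp add: distributions_on_def)
    then have "(\<Sum>s\<in>S. pmf (return_pmf t) s * f s) \<le> v" using L unfolding v_def by blast
    moreover have "(\<Sum>s\<in>S. pmf (return_pmf t) s * f s) = f t"
      using \<open>finite S\<close> that by (intro sum_pmf_const) auto
    ultimately show ?thesis by simp
  qed
  \<comment> \<open>The shortfalls \<open>v - f s\<close> are nonnegative and average to 0, hence
    vanish on the support.\<close>
  have "(\<Sum>s\<in>S. pmf p s * (v - f s)) = 0"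
    using sum_pmf_eq_1[OF assms]
    by (simp add: v_def right_diff_distrib sum_subtractf flip: sum_distrib_right)
  then have "\<forall>s\<in>S. pmf p s * (v - f s) = 0"
    using le assms(1) by (subst (asm) sum_nonneg_eq_0_iff) auto
  then have "f i = v" if "i \<in> set_pmf p" for i
    using that assms(2) by (force simp: set_pmf_iff)
  then show ?R using le by simp
next
  assume R: ?R
  obtain i where i: "i \<in> set_pmf p" using set_pmf_not_empty by fast
  have "(\<Sum>s\<in>S. pmf p s * f s) = f i"
    using R i assms by (intro sum_pmf_const) (auto intro!: antisym)
  then show ?L using R i assms(1) by (auto simp: distributions_on_def intro!: sum_pmf_le)
qed

text \<open>Absorbing the opponent's mixture turns the payoff of a mixed profile into a mean over
  the player's own pure strategies, the form that \<open>best_reply_iff\<close> treats.\<close>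

definition reply1 :: "('a, 'b) bimatrix \<Rightarrow> 'b pmf \<Rightarrow> 'a \<Rightarrow> real" where
  "reply1 G q s = (\<Sum>r\<in>strategies2 G. pmf q r * utility1 G (s, r))"

definition reply2 :: "('a, 'b) bimatrix \<Rightarrow> 'a pmf \<Rightarrow> 'b \<Rightarrow> real" where
  "reply2 G p r = (\<Sum>s\<in>strategies1 G. pmf p s * utility2 G (s, r))"

lemma payoff1_pair: "payoff1 G (pair_pmf p q) = (\<Sum>s\<in>strategies1 G. pmf p s * reply1 G q s)"
  unfolding payoff1_def profiles_def reply1_def
  by (simp add: pmf_pair sum_distrib_left mult.assoc sum.cartesian_product')

lemma payoff2_pair: "payoff2 G (pair_pmf p q) = (\<Sum>r\<in>strategies2 G. pmf q r * reply2 G p r)"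
  unfolding payoff2_def profiles_def reply2_def
  by (subst sum.cartesian_product', subst sum.swap)
     (simp add: pmf_pair sum_distrib_left mult_ac)

lemma nash_equilibrium_iff:
  assumes "bimatrix_game G"
  shows "nash_equilibrium G p q \<longleftrightarrow>
    set_pmf p \<subseteq> strategies1 G \<and> set_pmf q \<subseteq> strategies2 G \<and>
    (\<forall>i\<in>set_pmf p. \<forall>t\<in>strategies1 G. reply1 G q t \<le> reply1 G q i) \<and>
    (\<forall>j\<in>set_pmf q. \<forall>t\<in>strategies2 G. reply2 G p t \<le> reply2 G p j)"
proof -
  have fin: "finite (strategies1 G)" "finite (strategies2 G)"
    using assms by (auto simp: bimatrix_game_def)
  show ?thesis
    unfolding nash_equilibrium_def payoff1_pair payoff2_pair
    using best_reply_iff[OF fin(1)] best_reply_iff[OF fin(2)]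
    by (simp add: distributions_on_def cong: conj_cong)
qed

theorem nash_equilibrium_exists:
  assumes "bimatrix_game G"
  shows "\<exists>p q. nash_equilibrium G p q"
proof -
  have fin: "finite (strategies1 G)" "finite (strategies2 G)"
    and ne: "strategies1 G \<noteq> {}" "strategies2 G \<noteq> {}"
    using assms by (auto simp: bimatrix_game_def)
  obtain x y where x: "x \<in> prob_simplex (strategies1 G)" and y: "y \<in> prob_simplex (strategies2 G)"
    and 1: "\<forall>i\<in>strategies1 G. (\<Sum>j\<in>strategies2 G. y j * utility1 G (i, j)) \<le>
      (\<Sum>k\<in>strategies1 G. x k * (\<Sum>j\<in>strategies2 G. y j * utility1 G (k, j)))"
    and 2: "\<forall>j\<in>strategies2 G. (\<Sum>i\<in>strategies1 G. x i * utility2 G (i, j)) \<le>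
      (\<Sum>k\<in>strategies2 G. y k * (\<Sum>i\<in>strategies1 G. x i * utility2 G (i, k)))"
    using mixed_equilibrium_exists[OF fin(1) ne(1) fin(2) ne(2), of "utility1 G" "utility2 G"] by blast
  obtain p where p: "pmf p = x" "set_pmf p \<subseteq> strategies1 G" by (rule pmf_of_prob_simplex[OF fin(1) x])
  obtain q where q: "pmf q = y" "set_pmf q \<subseteq> strategies2 G" by (rule pmf_of_prob_simplex[OF fin(2) y])
  have "nash_equilibrium G p q"
    unfolding nash_equilibrium_def payoff1_pair payoff2_pair
  proof (intro conjI ballI)
    fix p' assume p': "p' \<in> distributions_on (strategies1 G)"
    show "(\<Sum>s\<in>strategies1 G. pmf p' s * reply1 G q s) \<le> (\<Sum>s\<in>strategies1 G. pmf p s * reply1 G q s)"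
      using 1 p' by (intro sum_pmf_le[OF fin(1)]) (auto simp: reply1_def p(1) q(1) distributions_on_def)
  next
    fix q' assume q': "q' \<in> distributions_on (strategies2 G)"
    show "(\<Sum>s\<in>strategies2 G. pmf q' s * reply2 G p s) \<le> (\<Sum>s\<in>strategies2 G. pmf q s * reply2 G p s)"
      using 2 q' by (intro sum_pmf_le[OF fin(2)]) (auto simp: reply2_def p(1) q(1) distributions_on_def)
  qed (use p q in \<open>auto simp: distributions_on_def\<close>)
  then show ?thesis by blast
qed

subsection \<open>Equilibrium payoffs are unions of rectangles\<close>

lemma compact_prob_simplex:
  assumes "finite S" shows "compact (prob_simplex S)"
proof -
  have "prob_simplex S = unit_cube S \<inter> {x. sum x S = 1}"
    using prob_simplex_subset_unit_cube[OF assms] by (auto simp: prob_simplex_def unit_cube_iff)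
  moreover have "closed {x. sum x S = (1::real)}"
    by (intro closed_Collect_eq continuous_on_sum continuous_on_coordinate continuous_on_const)
  ultimately show ?thesis by (simp add: compact_Int_closed compact_unit_cube)
qed

text \<open>The constraints are closed and linear, so they cut a compact convex set out of the
  simplex, and a linear functional maps it onto a compact convex set of reals. An interval with
  \<open>a > b\<close> covers the infeasible case.\<close>

lemma constrained_payoffs_interval:
  fixes g :: "'c \<Rightarrow> real" and H :: "('c \<Rightarrow> real) set"
  assumes "finite J"
  shows "\<exists>a b. (\<lambda>q. \<Sum>r\<in>S. pmf q r * g r) `
    {q. set_pmf q \<subseteq> J \<and> (\<forall>h\<in>H. 0 \<le> (\<Sum>r\<in>S. pmf q r * h r))} = {a..b}"
proof -
  define F :: "('c \<Rightarrow> real) \<Rightarrow> ('c \<Rightarrow> real) \<Rightarrow> real" where "F h x = (\<Sum>r\<in>S. x r * h r)" for h x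
  define P where "P = prob_simplex J \<inter> (\<Inter>h\<in>H. {x. 0 \<le> F h x})"
  have contF: "continuous_on A (F h)" for A h
    unfolding F_def
    by (intro continuous_on_sum continuous_on_mult continuous_on_coordinate continuous_on_const)
  have "closed (\<Inter>h\<in>H. {x. 0 \<le> F h x})"
    by (intro closed_INT ballI closed_Collect_le continuous_on_const contF)
  then have "compact P"
    unfolding P_def by (intro compact_Int_closed compact_prob_simplex assms)
  then have "compact (F g ` P)" by (intro compact_continuous_image contF)
  moreover have "convex (F g ` P)"
  proof (rule convexI)
    fix s t u v :: real
    assume "s \<in> F g ` P" "t \<in> F g ` P" and uv: "0 \<le> u" "0 \<le> v" "u + v = 1"
    then obtain x y where xy: "x \<in> P" "y \<in> P" "s = F g x" "t = F g y" by blast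
    define z where "z = (\<lambda>r. u * x r + v * y r)"
    have Fz: "F h z = u * F h x + v * F h y" for h
      by (simp add: F_def z_def sum_distrib_left sum.distrib[symmetric] algebra_simps)
    have "sum z J = u * sum x J + v * sum y J"
      by (simp add: z_def sum.distrib sum_distrib_left)
    then have "z \<in> prob_simplex J"
      using xy(1,2) uv by (simp add: P_def prob_simplex_def) (simp add: z_def)
    then have "z \<in> P" using xy(1,2) uv by (simp add: P_def Fz)
    then show "u *\<^sub>R s + v *\<^sub>R t \<in> F g ` P" using Fz xy(3,4) by (auto intro!: image_eqI[of _ _ z])
  qed
  ultimately obtain a b where ab: "F g ` P = {a..b}"
    using connected_compact_interval_1 convex_connected by meson
  have im: "(\<lambda>q. \<Sum>r\<in>S. pmf q r * g r) `
      {q. set_pmf q \<subseteq> J \<and> (\<forall>h\<in>H. 0 \<le> (\<Sum>r\<in>S. pmf q r * h r))} = F g ` P" (is "?f ` ?Q = _")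
  proof
    show "?f ` ?Q \<subseteq> F g ` P"
    proof
      fix t assume "t \<in> ?f ` ?Q"
      then obtain q where q: "q \<in> ?Q" "t = ?f q" by blast
      then have "pmf q \<in> P"
        using pmf_in_prob_simplex[OF assms, of q] by (simp add: P_def F_def)
      then show "t \<in> F g ` P" using q(2) by (auto simp: F_def)
    qed
    show "F g ` P \<subseteq> ?f ` ?Q"
    proof
      fix t assume "t \<in> F g ` P"
      then obtain x where x: "x \<in> P" "t = F g x" by blast
      then have "x \<in> prob_simplex J" by (simp add: P_def)
      then obtain q where q: "pmf q = x" "set_pmf q \<subseteq> J"
        by (rule pmf_of_prob_simplex[OF assms])
      then have "q \<in> ?Q" using x(1) by (simp add: P_def F_def)
      then show "t \<in> ?f ` ?Q" using x(2) q(1) by (auto simp: F_def)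
    qed
  qed
  show ?thesis unfolding im ab by blast
qed

theorem NEP_finite_union_of_rectangles:
  assumes G: "bimatrix_game G"
  shows "finite_union_of_rectangles (NEP G)"
proof -
  have fin: "finite (strategies1 G)" "finite (strategies2 G)"
    using assms by (auto simp: bimatrix_game_def)
  \<comment> \<open>Optimality of \<open>I\<close> constrains only the mixture \<open>q\<close>,
    optimality of \<open>J\<close> only \<open>p\<close>; this is the product structure. Supports
    are merely contained in \<open>I\<close> and \<open>J\<close>, which keeps the conditions
    closed.\<close>
  define Q where "Q I J = {q. set_pmf q \<subseteq> J \<and> (\<forall>i\<in>I. \<forall>t\<in>strategies1 G. reply1 G q t \<le> reply1 G q i)}" for I J
  define P where "P I J = {p. set_pmf p \<subseteq> I \<and> (\<forall>j\<in>J. \<forall>t\<in>strategies2 G. reply2 G p t \<le> reply2 G p j)}" for I J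
  \<comment> \<open>On \<open>Q I J\<close> all members of \<open>I\<close> earn the same against
    \<open>q\<close>, so any one of them gives player 1's payoff; likewise for
    \<open>J\<close>.\<close>
  define X where "X I J = (\<lambda>q. reply1 G q (SOME i. i \<in> I)) ` Q I J \<times>
    (\<lambda>p. reply2 G p (SOME j. j \<in> J)) ` P I J" for I J
  have Q_int: "\<exists>a b. (\<lambda>q. reply1 G q i) ` Q I J = {a..b}" if "J \<subseteq> strategies2 G" for i I J
  proof -
    have "reply1 G q t \<le> reply1 G q i \<longleftrightarrow>
        0 \<le> (\<Sum>r\<in>strategies2 G. pmf q r * (utility1 G (i, r) - utility1 G (t, r)))" for q i t
      by (simp add: reply1_def right_diff_distrib sum_subtractf)
    then have "Q I J = {q. set_pmf q \<subseteq> J \<and>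
        (\<forall>h\<in>(\<lambda>(i, t) r. utility1 G (i, r) - utility1 G (t, r)) ` (I \<times> strategies1 G).
          0 \<le> (\<Sum>r\<in>strategies2 G. pmf q r * h r))}"
      by (simp add: Q_def)
    then show ?thesis
      unfolding reply1_def
      using constrained_payoffs_interval[OF finite_subset[OF that fin(2)]] by presburger
  qed
  have P_int: "\<exists>a b. (\<lambda>p. reply2 G p j) ` P I J = {a..b}" if "I \<subseteq> strategies1 G" for j I J
  proof -
    have "reply2 G p t \<le> reply2 G p j \<longleftrightarrow>
        0 \<le> (\<Sum>r\<in>strategies1 G. pmf p r * (utility2 G (r, j) - utility2 G (r, t)))" for p j t
      by (simp add: reply2_def right_diff_distrib sum_subtractf)
    then have "P I J = {p. set_pmf p \<subseteq> I \<and>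
        (\<forall>h\<in>(\<lambda>(j, t) r. utility2 G (r, j) - utility2 G (r, t)) ` (J \<times> strategies2 G).
          0 \<le> (\<Sum>r\<in>strategies1 G. pmf p r * h r))}"
      by (simp add: P_def)
    then show ?thesis
      unfolding reply2_def
      using constrained_payoffs_interval[OF finite_subset[OF that fin(1)]] by presburger
  qed
  define \<P> where "\<P> = (Pow (strategies1 G) - {{}}) \<times> (Pow (strategies2 G) - {{}})"
  have fin_P: "finite \<P>" using fin by (simp add: \<P>_def)
  have rect: "rectangle (X I J)" if "(I, J) \<in> \<P>" "X I J \<noteq> {}" for I J
  proof -
    have IJ: "I \<subseteq> strategies1 G" "J \<subseteq> strategies2 G" using that(1) by (auto simp: \<P>_def)
    obtain a b where ab: "(\<lambda>q. reply1 G q (SOME i. i \<in> I)) ` Q I J = {a..b}"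
      using Q_int[OF IJ(2)] by blast
    obtain c d where cd: "(\<lambda>p. reply2 G p (SOME j. j \<in> J)) ` P I J = {c..d}"
      using P_int[OF IJ(1)] by blast
    have X: "X I J = {a..b} \<times> {c..d}" by (simp add: X_def ab cd)
    then have "a \<le> b" "c \<le> d" using that(2) by auto
    with X show ?thesis unfolding rectangle_def by blast
  qed
  have Q_eq: "reply1 G q i = reply1 G q i'"
    if "q \<in> Q I J" "I \<subseteq> strategies1 G" "i \<in> I" "i' \<in> I" for q I J i i'
    using that unfolding Q_def by (intro antisym; blast)
  have P_eq: "reply2 G p j = reply2 G p j'"
    if "p \<in> P I J" "J \<subseteq> strategies2 G" "j \<in> J" "j' \<in> J" for p I J j j'
    using that unfolding P_def by (intro antisym; blast)
  have payoffs: "payoff1 G (pair_pmf p q) = reply1 G q (SOME i. i \<in> I)"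
      "payoff2 G (pair_pmf p q) = reply2 G p (SOME j. j \<in> J)"
    if "(I, J) \<in> \<P>" "p \<in> P I J" "q \<in> Q I J" for I J p q
  proof -
    have IJ: "I \<subseteq> strategies1 G" "J \<subseteq> strategies2 G" "(SOME i. i \<in> I) \<in> I" "(SOME j. j \<in> J) \<in> J"
      using that(1) by (auto simp: \<P>_def some_in_eq)
    show "payoff1 G (pair_pmf p q) = reply1 G q (SOME i. i \<in> I)"
      unfolding payoff1_pair
    proof (rule sum_pmf_const[OF fin(1)])
      show "set_pmf p \<subseteq> strategies1 G" using that(2) IJ by (auto simp: P_def)
      show "reply1 G q s = reply1 G q (SOME i. i \<in> I)" if "s \<in> set_pmf p" for s
        using that \<open>p \<in> P I J\<close> by (intro Q_eq[OF \<open>q \<in> Q I J\<close> IJ(1) _ IJ(3)]) (auto simp: P_def)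
    qed
    show "payoff2 G (pair_pmf p q) = reply2 G p (SOME j. j \<in> J)"
      unfolding payoff2_pair
    proof (rule sum_pmf_const[OF fin(2)])
      show "set_pmf q \<subseteq> strategies2 G" using that(3) IJ by (auto simp: Q_def)
      show "reply2 G p s = reply2 G p (SOME j. j \<in> J)" if "s \<in> set_pmf q" for s
        using that \<open>q \<in> Q I J\<close> by (intro P_eq[OF \<open>p \<in> P I J\<close> IJ(2) _ IJ(4)]) (auto simp: Q_def)
    qed
  qed
  have "NEP G = (\<Union>(I, J)\<in>\<P>. X I J)"
  proof
    show "NEP G \<subseteq> (\<Union>(I, J)\<in>\<P>. X I J)"
    proof
      fix w assume "w \<in> NEP G"
      then obtain p q where w: "w = (payoff1 G (pair_pmf p q), payoff2 G (pair_pmf p q))"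
        and ne: "nash_equilibrium G p q" by (auto simp: NEP_def)
      \<comment> \<open>An equilibrium is captured by taking its own supports for \<open>I\<close>
        and \<open>J\<close>.\<close>
      have IJ: "(set_pmf p, set_pmf q) \<in> \<P>" "p \<in> P (set_pmf p) (set_pmf q)" "q \<in> Q (set_pmf p) (set_pmf q)"
        using ne unfolding nash_equilibrium_iff[OF G]
        by (simp_all add: \<P>_def P_def Q_def set_pmf_not_empty)
      then have "w \<in> X (set_pmf p) (set_pmf q)"
        unfolding w payoffs[OF IJ] X_def by blast
      then show "w \<in> (\<Union>(I, J)\<in>\<P>. X I J)" using IJ(1) by blast
    qed
    show "(\<Union>(I, J)\<in>\<P>. X I J) \<subseteq> NEP G"
    proof
      fix w assume "w \<in> (\<Union>(I, J)\<in>\<P>. X I J)"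
      then obtain I J p q where IJ: "(I, J) \<in> \<P>" and pq: "p \<in> P I J" "q \<in> Q I J"
        and w: "w = (reply1 G q (SOME i. i \<in> I), reply2 G p (SOME j. j \<in> J))"
        by (auto simp: X_def)
      have "nash_equilibrium G p q"
        unfolding nash_equilibrium_iff[OF G] using IJ pq unfolding \<P>_def P_def Q_def by blast
      then show "w \<in> NEP G" unfolding NEP_def w payoffs[OF IJ pq, symmetric] by blast
    qed
  qed
  \<comment> \<open>Rectangles are nonempty by definition, so empty products are dropped.\<close>
  also have "\<dots> = \<Union>((\<lambda>(I, J). X I J) ` \<P> - {{}})" by auto
  finally have eq: "NEP G = \<Union>((\<lambda>(I, J). X I J) ` \<P> - {{}})" .
  show ?thesis
    unfolding finite_union_of_rectangles_def
  proof (intro exI conjI)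
    show "NEP G = \<Union>((\<lambda>(I, J). X I J) ` \<P> - {{}})" by (rule eq)
    show "finite ((\<lambda>(I, J). X I J) ` \<P> - {{}})" using fin_P by simp
    show "\<forall>R\<in>(\<lambda>(I, J). X I J) ` \<P> - {{}}. rectangle R" using rect by auto
  qed
qed

subsection \<open>Realizing unions of rectangles\<close>

text \<open>For a product distribution the incentive constraint factors into the probability of
  \<open>s\<close> times the advantage of \<open>s\<close> over \<open>t\<close>. It therefore binds
  only on the support, where it is the best-reply condition.\<close>

lemma nash_equilibrium_iff_correlated:
  assumes G: "bimatrix_game G"
  shows "nash_equilibrium G p q \<longleftrightarrow> correlated_equilibrium G (pair_pmf p q)"
proof -
  have 1: "(\<Sum>r\<in>strategies2 G. pmf (pair_pmf p q) (s, r) * (utility1 G (s, r) - utility1 G (t, r)))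
      = pmf p s * (reply1 G q s - reply1 G q t)" for s t
    by (simp add: pmf_pair reply1_def sum_distrib_left right_diff_distrib sum_subtractf mult.assoc)
  have 2: "(\<Sum>r\<in>strategies1 G. pmf (pair_pmf p q) (r, s) * (utility2 G (r, s) - utility2 G (r, t)))
      = pmf q s * (reply2 G p s - reply2 G p t)" for s t
    by (simp add: pmf_pair reply2_def sum_distrib_left right_diff_distrib sum_subtractf mult_ac)
  have nonneg: "0 \<le> pmf m s * (c :: real) \<longleftrightarrow> (s \<in> set_pmf m \<longrightarrow> 0 \<le> c)" for m :: "'x pmf" and s c
    by (cases "s \<in> set_pmf m") (auto simp: set_pmf_iff zero_le_mult_iff pmf_nonneg less_le)
  have dist: "pair_pmf p q \<in> distributions_on (profiles G) \<longleftrightarrow>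
      set_pmf p \<subseteq> strategies1 G \<and> set_pmf q \<subseteq> strategies2 G"
    using set_pmf_not_empty[of p] set_pmf_not_empty[of q]
    by (auto simp: distributions_on_def profiles_def times_subset_iff)
  show ?thesis
    unfolding nash_equilibrium_iff[OF G] correlated_equilibrium_def 1 2 nonneg dist by auto
qed

lemma NEP_subset_CEP: "bimatrix_game G \<Longrightarrow> NEP G \<subseteq> CEP G"
  by (auto simp: NEP_def CEP_def nash_equilibrium_iff_correlated)

text \<open>Incentive constraints and payoffs are linear in the distribution, so a mixture of two
  correlated equilibria is one again.\<close>

lemma convex_CEP:
  assumes G: "bimatrix_game G"
  shows "convex (CEP G)"
proof (rule convexI)
  fix w z :: "real \<times> real" and u v :: real
  assume "w \<in> CEP G" "z \<in> CEP G" and uv: "0 \<le> u" "0 \<le> v" "u + v = 1"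
  then obtain \<mu> \<nu> where w: "w = (payoff1 G \<mu>, payoff2 G \<mu>)" and \<mu>: "correlated_equilibrium G \<mu>"
    and z: "z = (payoff1 G \<nu>, payoff2 G \<nu>)" and \<nu>: "correlated_equilibrium G \<nu>"
    by (auto simp: CEP_def)
  have fin: "finite (profiles G)" using G by (auto simp: bimatrix_game_def profiles_def)
  define x where "x = (\<lambda>s. u * pmf \<mu> s + v * pmf \<nu> s)"
  have m: "pmf \<mu> \<in> prob_simplex (profiles G)" "pmf \<nu> \<in> prob_simplex (profiles G)"
    using \<mu> \<nu> fin
    by (auto simp: correlated_equilibrium_def distributions_on_def intro!: pmf_in_prob_simplex)
  have "sum x (profiles G) = u * sum (pmf \<mu>) (profiles G) + v * sum (pmf \<nu>) (profiles G)"
    by (simp add: x_def sum.distrib sum_distrib_left)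
  then have "x \<in> prob_simplex (profiles G)"
    using m uv by (simp add: prob_simplex_def) (simp add: x_def)
  then obtain \<kappa> where \<kappa>: "pmf \<kappa> = x" "set_pmf \<kappa> \<subseteq> profiles G"
    by (rule pmf_of_prob_simplex[OF fin])
  \<comment> \<open>The embedding \<open>e\<close> lets one identity serve the rows, the columns and
    the whole profile set.\<close>
  have mix: "(\<Sum>s\<in>S. pmf \<kappa> (e s) * f s) = u * (\<Sum>s\<in>S. pmf \<mu> (e s) * f s) + v * (\<Sum>s\<in>S. pmf \<nu> (e s) * f s)"
    for S :: "'x set" and e f
    by (simp add: \<kappa>(1) x_def distrib_right sum.distrib sum_distrib_left mult.assoc)
  have "correlated_equilibrium G \<kappa>"
    using \<mu> \<nu> \<kappa>(2) uv unfolding correlated_equilibrium_def mix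
    by (auto simp: distributions_on_def)
  moreover have "u *\<^sub>R w + v *\<^sub>R z = (payoff1 G \<kappa>, payoff2 G \<kappa>)"
    using mix[of "\<lambda>s. s"] by (simp add: w z payoff1_def payoff2_def)
  ultimately show "u *\<^sub>R w + v *\<^sub>R z \<in> CEP G" unfolding CEP_def by blast
qed

section \<open>The block game and its equilibria\<close>

text \<open>Block \<open>k\<close> consists of the strategies \<open>2 * k\<close> and \<open>2 * k + 1\<close>; inside it each player only
  controls the other one's payoff. Choosing a higher block than the opponent costs 1.\<close>

definition block_game ::
    "nat \<Rightarrow> (nat \<Rightarrow> real) \<Rightarrow> (nat \<Rightarrow> real) \<Rightarrow> (nat \<Rightarrow> real) \<Rightarrow> (nat \<Rightarrow> real) \<Rightarrow> (nat, nat) bimatrix" where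
  "block_game n a b c d = \<lparr>strategies1 = {..<2 * n}, strategies2 = {..<2 * n},
     utility1 = (\<lambda>(s, t). (if even t then a (t div 2) else b (t div 2)) - of_bool (t div 2 < s div 2)),
     utility2 = (\<lambda>(s, t). (if even s then c (s div 2) else d (s div 2)) - of_bool (s div 2 < t div 2))\<rparr>"

lemma strategies_block_game:
  "strategies1 (block_game n a b c d) = {..<2 * n}" "strategies2 (block_game n a b c d) = {..<2 * n}"
  by (simp_all add: block_game_def)

lemma bimatrix_game_block_game: "0 < n \<Longrightarrow> bimatrix_game (block_game n a b c d)"
  by (simp add: bimatrix_game_def block_game_def lessThan_empty_iff)

text \<open>A player's own choice enters the own payoff only through the penalty. Deviating to block
  0 saves the whole expected penalty, which must then be 0; conversely, where blocks agree no
  penalty is paid and no deviation gains.\<close>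

lemma correlated_equilibrium_block_game:
  assumes "0 < n"
  shows "correlated_equilibrium (block_game n a b c d) \<mu> \<longleftrightarrow>
    set_pmf \<mu> \<subseteq> {..<2 * n} \<times> {..<2 * n} \<and> (\<forall>(s, t)\<in>set_pmf \<mu>. s div 2 = t div 2)" (is "?L \<longleftrightarrow> ?R")
proof
  assume L: ?L
  have sub: "set_pmf \<mu> \<subseteq> {..<2 * n} \<times> {..<2 * n}"
    using L by (simp add: correlated_equilibrium_def distributions_on_def profiles_def block_game_def)
  have dev1: "0 \<le> (\<Sum>r<2 * n. pmf \<mu> (s, r) *
      (utility1 (block_game n a b c d) (s, r) - utility1 (block_game n a b c d) (t, r)))"
    and dev2: "0 \<le> (\<Sum>r<2 * n. pmf \<mu> (r, s) *
      (utility2 (block_game n a b c d) (r, s) - utility2 (block_game n a b c d) (r, t)))"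
    if "s < 2 * n" "t < 2 * n" for s t
    using L that by (simp_all add: correlated_equilibrium_def strategies_block_game)
  have vanish: "\<forall>r\<in>S. f r = 0" if "finite S" "0 \<le> (\<Sum>r\<in>S. - f r)" "\<And>r. 0 \<le> f r"
    for S and f :: "nat \<Rightarrow> real"
  proof -
    have "sum f S = 0"
      using that sum_nonneg[of S f] by (simp add: sum_negf)
    then show ?thesis using that(1,3) by (simp add: sum_nonneg_eq_0_iff)
  qed
  have "s div 2 = t div 2" if st: "(s, t) \<in> set_pmf \<mu>" for s t
  proof -
    have s: "s < 2 * n" and t: "t < 2 * n" using sub st by auto
    have pos: "pmf \<mu> (s, t) \<noteq> 0" using st by (simp add: set_pmf_iff)
    \<comment> \<open>Strategy 0 is never penalized and the part set by the opponent cancels, so the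
      difference is minus the penalty of \<open>s\<close>.\<close>
    have "0 \<le> (\<Sum>r<2 * n. pmf \<mu> (s, r) *
        (utility1 (block_game n a b c d) (s, r) - utility1 (block_game n a b c d) (0, r)))"
      using dev1[of s 0] s assms by simp
    then have "0 \<le> (\<Sum>r<2 * n. - (pmf \<mu> (s, r) * of_bool (r div 2 < s div 2)))"
      by (simp add: block_game_def)
    then have "\<forall>r\<in>{..<2 * n}. pmf \<mu> (s, r) * of_bool (r div 2 < s div 2) = (0 :: real)"
      by (intro vanish) auto
    with t pos have ge: "\<not> t div 2 < s div 2" by force
    have "0 \<le> (\<Sum>r<2 * n. pmf \<mu> (r, t) *
        (utility2 (block_game n a b c d) (r, t) - utility2 (block_game n a b c d) (r, 0)))"
      using dev2[of t 0] t assms by simp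
    then have "0 \<le> (\<Sum>r<2 * n. - (pmf \<mu> (r, t) * of_bool (r div 2 < t div 2)))"
      by (simp add: block_game_def)
    then have "\<forall>r\<in>{..<2 * n}. pmf \<mu> (r, t) * of_bool (r div 2 < t div 2) = (0 :: real)"
      by (intro vanish) auto
    with s pos have "\<not> s div 2 < t div 2" by force
    with ge show ?thesis by simp
  qed
  with sub show ?R by blast
next
  assume R: ?R
  have zero: "pmf \<mu> (s, t) = 0" if "s div 2 \<noteq> t div 2" for s t
    using R that by (auto simp: set_pmf_iff)
  \<comment> \<open>The constraints hold term by term: in unequal blocks the probability is 0, in
    equal blocks \<open>s\<close> carries no penalty.\<close>
  have "0 \<le> pmf \<mu> (s, r) * (utility1 (block_game n a b c d) (s, r) - utility1 (block_game n a b c d) (t, r))"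
      "0 \<le> pmf \<mu> (r, s) * (utility2 (block_game n a b c d) (r, s) - utility2 (block_game n a b c d) (r, t))"
    for s r t
    by (cases "s div 2 = r div 2"; simp add: block_game_def zero)+
  then show ?L
    using R by (simp add: correlated_equilibrium_def distributions_on_def profiles_def sum_nonneg)
       (simp add: block_game_def)
qed

text \<open>Supplies the mixture over the two strategies of a block that gives the opponent a
  prescribed payoff between the end points.\<close>

lemma two_point_pmf:
  assumes "i \<noteq> j" "x \<in> {a..b}"
  obtains p where "set_pmf p \<subseteq> {i, j}" "pmf p i * a + pmf p j * b = x"
proof -
  have "x \<in> closed_segment a b" using assms(2) by (simp add: closed_segment_eq_real_ivl)
  then obtain l where l: "0 \<le> l" "l \<le> 1" "x = (1 - l) * a + l * b"
    by (auto simp: in_segment)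
  have "(\<lambda>k. if k = i then 1 - l else if k = j then l else 0) \<in> prob_simplex {i, j}"
    using l assms(1) by (auto simp: prob_simplex_def)
  then obtain p where "pmf p = (\<lambda>k. if k = i then 1 - l else if k = j then l else 0)" "set_pmf p \<subseteq> {i, j}"
    by (rule pmf_of_prob_simplex[rotated]) simp_all
  then show thesis using l assms(1) by (intro that[of p]) auto
qed

context
  fixes n :: nat and a b c d :: "nat \<Rightarrow> real"
  assumes n: "0 < n" and ab: "\<And>k. k < n \<Longrightarrow> a k \<le> b k" and cd: "\<And>k. k < n \<Longrightarrow> c k \<le> d k"
begin

abbreviation "\<G> \<equiv> block_game n a b c d"

text \<open>Independent choices that always land in equal blocks must stay in a single block
  \<open>k\<close>, where payoffs average end points of the sides of rectangle \<open>k\<close>.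
  Conversely, each mixture inside block \<open>k\<close> sets the opponent's payoff freely.\<close>

lemma NEP_block_game: "NEP \<G> = (\<Union>k<n. {a k..b k} \<times> {c k..d k})"
proof
  have fin: "finite (profiles \<G>)" by (simp add: profiles_def block_game_def)
  show "NEP \<G> \<subseteq> (\<Union>k<n. {a k..b k} \<times> {c k..d k})"
  proof
    fix w assume "w \<in> NEP \<G>"
    then obtain p q where w: "w = (payoff1 \<G> (pair_pmf p q), payoff2 \<G> (pair_pmf p q))"
      and ce: "correlated_equilibrium \<G> (pair_pmf p q)"
      by (auto simp: NEP_def nash_equilibrium_iff_correlated[OF bimatrix_game_block_game[OF n]])
    note supp = ce[unfolded correlated_equilibrium_block_game[OF n]]
    have sub: "set_pmf (pair_pmf p q) \<subseteq> profiles \<G>"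
      using supp by (simp add: profiles_def block_game_def)
    obtain i where i: "i \<in> set_pmf p" using set_pmf_not_empty[of p] by blast
    obtain j where j: "j \<in> set_pmf q" using set_pmf_not_empty[of q] by blast
    have same: "s div 2 = t div 2" if "s \<in> set_pmf p" "t \<in> set_pmf q" for s t
      using supp that by auto
    define k where "k = i div 2"
    have "s div 2 = k \<and> t div 2 = k" if "(s, t) \<in> set_pmf (pair_pmf p q)" for s t
      using that same[of s t] same[OF i, of t] by (simp add: k_def)
    moreover have "k < n" using supp i j by (auto simp: k_def)
    ultimately have u: "utility1 \<G> s \<in> {a k..b k}" "utility2 \<G> s \<in> {c k..d k}"
      if "s \<in> set_pmf (pair_pmf p q)" for s
      using that ab[of k] cd[of k] by (cases s; force simp: block_game_def)+
    have "payoff1 \<G> (pair_pmf p q) \<in> {a k..b k}" "payoff2 \<G> (pair_pmf p q) \<in> {c k..d k}"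
      unfolding payoff1_def payoff2_def
      using u sum_pmf_le[OF fin sub] sum_pmf_ge[OF fin sub] by (simp_all add: atLeastAtMost_iff)
    then show "w \<in> (\<Union>k<n. {a k..b k} \<times> {c k..d k})" using \<open>k < n\<close> w by auto
  qed
  show "(\<Union>k<n. {a k..b k} \<times> {c k..d k}) \<subseteq> NEP \<G>"
  proof clarify
    fix k x y assume k: "k < n" and x: "x \<in> {a k..b k}" and y: "y \<in> {c k..d k}"
    have ne: "2 * k \<noteq> 2 * k + 1" by simp
    \<comment> \<open>The roles cross: \<open>q\<close> produces player 1's payoff \<open>x\<close>,
      and \<open>p\<close> produces player 2's payoff \<open>y\<close>.\<close>
    obtain q where q: "set_pmf q \<subseteq> {2 * k, 2 * k + 1}" "pmf q (2 * k) * a k + pmf q (2 * k + 1) * b k = x"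
      by (rule two_point_pmf[OF ne x])
    obtain p where p: "set_pmf p \<subseteq> {2 * k, 2 * k + 1}" "pmf p (2 * k) * c k + pmf p (2 * k + 1) * d k = y"
      by (rule two_point_pmf[OF ne y])
    have block: "s < 2 * n \<and> s div 2 = k" if "s \<in> {2 * k, 2 * k + 1}" for s
      using that k by auto
    have "nash_equilibrium \<G> p q"
      unfolding nash_equilibrium_iff_correlated[OF bimatrix_game_block_game[OF n]] correlated_equilibrium_block_game[OF n]
      using p(1) q(1) block by fastforce
    have sum: "(\<Sum>s<2 * n. pmf m s * f s) = pmf m (2 * k) * f (2 * k) + pmf m (2 * k + 1) * f (2 * k + 1)"
      if "set_pmf m \<subseteq> {2 * k, 2 * k + 1}" for m and f :: "nat \<Rightarrow> real"
    proof -
      have "(\<Sum>s<2 * n. pmf m s * f s) = (\<Sum>s\<in>{2 * k, 2 * k + 1}. pmf m s * f s)"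
        using that k by (intro sum.mono_neutral_right) (auto simp: set_pmf_iff)
      then show ?thesis by simp
    qed
    have "payoff1 \<G> (pair_pmf p q) = x"
      unfolding payoff1_pair
    proof (rule sum_pmf_const)
      show "reply1 \<G> q s = x" if "s \<in> set_pmf p" for s
      proof -
        have "s div 2 = k" using that p(1) block by blast
        then show ?thesis using q(2) sum[OF q(1)] by (simp add: reply1_def block_game_def)
      qed
    qed (use p(1) block in \<open>auto simp: block_game_def\<close>)
    moreover have "payoff2 \<G> (pair_pmf p q) = y"
      unfolding payoff2_pair
    proof (rule sum_pmf_const)
      show "reply2 \<G> p s = y" if "s \<in> set_pmf q" for s
      proof -
        have "s div 2 = k" using that q(1) block by blast
        then show ?thesis using p(2) sum[OF p(1)] by (simp add: reply2_def block_game_def)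
      qed
    qed (use q(1) block in \<open>auto simp: block_game_def\<close>)
    ultimately show "(x, y) \<in> NEP \<G>" using \<open>nash_equilibrium \<G> p q\<close> unfolding NEP_def by blast
  qed
qed

text \<open>A correlated equilibrium averages pure profiles in equal blocks, and each of these pays
  a corner of a rectangle. The other inclusion is convexity of \<open>CEP\<close>.\<close>

lemma CEP_block_game: "CEP \<G> = convex hull (NEP \<G>)"
proof
  show "convex hull (NEP \<G>) \<subseteq> CEP \<G>"
    by (intro hull_minimal NEP_subset_CEP convex_CEP bimatrix_game_block_game n)
  show "CEP \<G> \<subseteq> convex hull (NEP \<G>)"
  proof
    fix w assume "w \<in> CEP \<G>"
    then obtain \<mu> where w: "w = (payoff1 \<G> \<mu>, payoff2 \<G> \<mu>)" and ce: "correlated_equilibrium \<G> \<mu>"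
      by (auto simp: CEP_def)
    note supp = ce[unfolded correlated_equilibrium_block_game[OF n]]
    have fin: "finite (profiles \<G>)" by (simp add: profiles_def block_game_def)
    have sub: "set_pmf \<mu> \<subseteq> profiles \<G>" using supp by (simp add: profiles_def block_game_def)
    have restrict: "(\<Sum>s\<in>profiles \<G>. pmf \<mu> s * f s) = (\<Sum>s\<in>set_pmf \<mu>. pmf \<mu> s * f s)" for f
      using fin sub by (intro sum.mono_neutral_right) (auto simp: set_pmf_iff)
    have "w = (\<Sum>s\<in>set_pmf \<mu>. pmf \<mu> s *\<^sub>R (utility1 \<G> s, utility2 \<G> s))"
      by (simp add: w payoff1_def payoff2_def restrict prod_eq_iff fst_sum snd_sum)
    moreover have "(utility1 \<G> s, utility2 \<G> s) \<in> convex hull (NEP \<G>)" if "s \<in> set_pmf \<mu>" for s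
    proof (rule hull_inc)
      obtain i j where s: "s = (i, j)" by force
      have "i div 2 = j div 2" "i div 2 < n" using supp that s by auto
      then show "(utility1 \<G> s, utility2 \<G> s) \<in> NEP \<G>"
        using ab[of "i div 2"] cd[of "i div 2"] unfolding NEP_block_game s
        by (intro UN_I[of "i div 2"]) (auto simp: block_game_def)
    qed
    moreover have "finite (set_pmf \<mu>)" using sub fin by (rule finite_subset)
    ultimately show "w \<in> convex hull (NEP \<G>)"
      using convex_sum[of "set_pmf \<mu>" "convex hull (NEP \<G>)" "pmf \<mu>" "\<lambda>s. (utility1 \<G> s, utility2 \<G> s)"]
      by (simp only: convex_convex_hull sum_pmf_eq_1 order_refl pmf_nonneg)
  qed
qed

end

lemma realize_rectangles:
  assumes U: "finite_union_of_rectangles U" and "U \<noteq> {}"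
  shows "\<exists>G :: (nat, nat) bimatrix. bimatrix_game G \<and> NEP G = U \<and> CEP G = convex hull U"
proof -
  obtain \<R> where R: "finite \<R>" "\<forall>R\<in>\<R>. rectangle R" "U = \<Union>\<R>"
    using U unfolding finite_union_of_rectangles_def by blast
  define n where "n = card \<R>"
  obtain e where "bij_betw e {0..<n} \<R>"
    using ex_bij_betw_nat_finite[OF R(1)] unfolding n_def by blast
  then have e: "e ` {..<n} = \<R>" by (simp add: bij_betw_def atLeast0LessThan)
  \<comment> \<open>Nonemptiness of \<open>U\<close> yields at least one block, so the strategy sets
    are nonempty.\<close>
  have "0 < n" using R \<open>U \<noteq> {}\<close> by (auto simp: n_def card_gt_0_iff)
  have "rectangle (e k)" if "k < n" for k using R(2) that unfolding e[symmetric] by simp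
  then have "\<forall>k. \<exists>a b c d. k < n \<longrightarrow> a \<le> b \<and> c \<le> d \<and> e k = {a..b} \<times> {c..d}"
    unfolding rectangle_def by blast
  then obtain a b c d where
    abcd: "\<And>k. k < n \<Longrightarrow> a k \<le> b k \<and> c k \<le> d k \<and> e k = {a k..b k} \<times> {c k..d k}"
    by metis
  have "U = (\<Union>k<n. e k)" unfolding R(3) e[symmetric] by simp
  then have "U = (\<Union>k<n. {a k..b k} \<times> {c k..d k})" using abcd by simp
  then have "NEP (block_game n a b c d) = U"
    using NEP_block_game[OF \<open>0 < n\<close>, of a b c d] abcd by simp
  moreover have "CEP (block_game n a b c d) = convex hull NEP (block_game n a b c d)"
    using CEP_block_game[OF \<open>0 < n\<close>, of a b c d] abcd by blast
  ultimately show ?thesis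
    using bimatrix_game_block_game[OF \<open>0 < n\<close>, of a b c d]
    by (intro exI[of _ "block_game n a b c d"]) simp
qed

theorem proposition2:
  shows "(\<forall>G :: ('a, 'b) bimatrix. bimatrix_game G \<longrightarrow> finite_union_of_rectangles (NEP G)) \<and>
    (\<forall>U. finite_union_of_rectangles U \<and> U \<noteq> {} \<longrightarrow>
       (\<exists>G :: (nat, nat) bimatrix. bimatrix_game G \<and> NEP G = U)) \<and>
    (\<forall>G :: ('a, 'b) bimatrix. bimatrix_game G \<longrightarrow>
       (\<exists>G' :: (nat, nat) bimatrix. bimatrix_game G' \<and>
          NEP G' = NEP G \<and> CEP G' = convex hull (NEP G)))"
proof (intro conjI allI impI)
  fix G :: "('a, 'b) bimatrix"
  assume G: "bimatrix_game G"
  show fur: "finite_union_of_rectangles (NEP G)"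
    by (rule NEP_finite_union_of_rectangles[OF G])
  \<comment> \<open>Nash's theorem enters here: the realization requires a nonempty payoff
    set.\<close>
  have "NEP G \<noteq> {}"
    using nash_equilibrium_exists[OF G] unfolding NEP_def by blast
  then show "\<exists>G' :: (nat, nat) bimatrix. bimatrix_game G' \<and>
      NEP G' = NEP G \<and> CEP G' = convex hull (NEP G)"
    by (rule realize_rectangles[OF fur])
next
  fix U :: "(real \<times> real) set"
  assume "finite_union_of_rectangles U \<and> U \<noteq> {}"
  then show "\<exists>G :: (nat, nat) bimatrix. bimatrix_game G \<and> NEP G = U"
    using realize_rectangles[of U] by blast
qed

end
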